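(* Fix a value of $\lambda$ and consider interactions of 1- and 3-waves (defined in the context), all having this same $\lambda$. (i) Two interacting waves of different families cross each other without changing strengths: if a 3-wave of strength $\delta_3$ (on the left) interacts with a 1-wave of strength $\delta_1$ (on the right), then the outgoing waves have strengths $\varepsilon_1=\delta_1$ and $\varepsilon_3=\delta_3$. (ii) Let $\alpha_i,\beta_i$ be the strengths of two interacting waves of the same family $i\in\{1,3\}$, let $\varepsilon_1,\varepsilon_3$ be the strengths of the outgoing waves, and let $j\in\{1,3\}$, $j\ne i$ (so that $\varepsilon_j$ is the reflected wave). (ii.a) If both incoming waves are shocks, then the outgoing wave $\varepsilon_i$ of the same family is a shock and satisfies $|\varepsilon_i|>\max\{|\alpha_i|,|\beta_i|\}$; the reflected wave $\varepsilon_j$ is a rarefaction. (ii.b) If the incoming waves have different signs, then the reflected wave $\varepsilon_j$ is a shock, and both the amounts of shocks and of rarefactions of the $i$-family decrease across the interaction. Moreover, if $\alpha_i<0<\beta_i$ (where the shock $\alpha_i$ may be either the left or the right incoming wave), then $$|\varepsilon_j|\le c(\alpha_i)\cdot\min\{|\alpha_i|,|\beta_i|\},\qquad c(z)=\frac{\cosh z-1}{\cosh z+1}.$$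
   Context: The system is $v_t-u_x=0$, $u_t+(a^2(\lambda)/v)_x=0$, $\lambda_t=0$, with $v>0$, $u\in\mathbb{R}$, $\lambda\in[0,1]$, and $a:[0,1]\to(0,\infty)$ of class $C^1$. Let $h(\varepsilon)=\varepsilon$ for $\varepsilon\ge0$ and $h(\varepsilon)=\sinh\varepsilon$ for $\varepsilon<0$. A 1-wave of strength $\varepsilon$ connects a left state $(v_o,u_o,\lambda)$ to the right state $(v_oe^{2\varepsilon},u_o+2a(\lambda)h(\varepsilon),\lambda)$; a 3-wave of strength $\varepsilon$ connects a left state $(v_o,u_o,\lambda)$ to the right state $(v_oe^{-2\varepsilon},u_o+2a(\lambda)h(\varepsilon),\lambda)$. A wave is a rarefaction if its strength is positive and a shock if its strength is negative. When two adjacent waves interact, the outgoing waves are the unique 1-wave of strength $\varepsilon_1$ followed (from left to right) by the unique 3-wave of strength $\varepsilon_3$ connecting the leftmost state to the rightmost state. Two rarefactions of the same family do not interact. In (ii.b), the amount of shocks (rarefactions) of family $i$ means the total absolute strength of the shocks (rarefactions) of family $i$ among the incoming, respectively outgoing, waves; e.g. with $\alpha_i<0<\beta_i$ the incoming amounts are $|\alpha_i|$ and $\beta_i$, and the outgoing ones are $\max\{-\varepsilon_i,0\}$ and $\max\{\varepsilon_i,0\}$. *)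

theory Defs
  imports "HOL-Analysis.Analysis"
begin

text \<open>
  Elementary waves of the system v_t - u_x = 0, u_t + (a^2(lambda)/v)_x = 0, lambda_t = 0.
  A state is a triple (v, u, lambda).
\<close>

type_synonym state = "real \<times> real \<times> real"

definition states :: "state set" where
  "states = {(v, u, l). v > 0 \<and> l \<in> {0..1}}"

text \<open>
  Class C^1 on the closed interval [0,1], with one-sided derivatives at the endpoints
  (the library's \<open>C1_differentiable_on\<close> would require two-sided ones).
\<close>

definition admissible_pressure_coeff :: "(real \<Rightarrow> real) \<Rightarrow> bool" where
  "admissible_pressure_coeff a \<longleftrightarrow>
     (\<forall>l\<in>{0..1}. a l > 0) \<and>
     (\<exists>a'. (\<forall>l\<in>{0..1}. (a has_real_derivative a' l) (at l within {0..1})) \<and>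
           continuous_on {0..1} a')"

definition h :: "real \<Rightarrow> real" where
  "h e = (if e \<ge> 0 then e else sinh e)"

datatype family = Fam1 | Fam3

fun v_sign :: "family \<Rightarrow> real" where
  "v_sign Fam1 = 1"
| "v_sign Fam3 = -1"

text \<open>\<open>wave a i e S T\<close>: the state \<open>S\<close> on the left is connected to \<open>T\<close> on the right by an
  \<open>i\<close>-wave of strength \<open>e\<close>.\<close>

definition wave :: "(real \<Rightarrow> real) \<Rightarrow> family \<Rightarrow> real \<Rightarrow> state \<Rightarrow> state \<Rightarrow> bool" where
  "wave a i e S T \<longleftrightarrow> S \<in> states \<and>
     (case S of (v, u, l) \<Rightarrow> T = (v * exp (v_sign i * 2 * e), u + 2 * a l * h e, l))"

definition is_shock :: "real \<Rightarrow> bool" where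
  "is_shock e \<longleftrightarrow> e < 0"

definition is_rarefaction :: "real \<Rightarrow> bool" where
  "is_rarefaction e \<longleftrightarrow> e > 0"

text \<open>Total strength of the shocks (rarefactions) in a list of wave strengths.\<close>

definition shock_amount :: "real list \<Rightarrow> real" where
  "shock_amount es = (\<Sum>e\<leftarrow>filter is_shock es. \<bar>e\<bar>)"

definition rarefaction_amount :: "real list \<Rightarrow> real" where
  "rarefaction_amount es = (\<Sum>e\<leftarrow>filter is_rarefaction es. \<bar>e\<bar>)"

definition connects :: "(real \<Rightarrow> real) \<Rightarrow> state \<Rightarrow> state \<Rightarrow> (family \<Rightarrow> real) \<Rightarrow> bool" where
  "connects a Sl Sr e \<longleftrightarrow> (\<exists>Sm. wave a Fam1 (e Fam1) Sl Sm \<and> wave a Fam3 (e Fam3) Sm Sr)"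

text \<open>The strengths of the outgoing waves, indexed by the family; they are well defined by
  \<open>connects_ex1\<close> below.\<close>

definition outgoing :: "(real \<Rightarrow> real) \<Rightarrow> state \<Rightarrow> state \<Rightarrow> family \<Rightarrow> real" where
  "outgoing a Sl Sr = (THE e. connects a Sl Sr e)"

definition c :: "real \<Rightarrow> real" where
  "c z = (cosh z - 1) / (cosh z + 1)"

lemma h_less: "h x < h y" if "x < y"
  using that by (auto simp: h_def intro: order_less_le_trans[of _ 0])

lemma continuous_on_h: "continuous_on UNIV h"
proof -
  have "continuous_on ({0..} \<union> {..0::real}) (\<lambda>e. if e \<ge> 0 then e else sinh e)"
    by (intro continuous_on_cases) (auto intro!: continuous_intros)
  moreover have "{0..} \<union> {..0::real} = UNIV"
    by auto
  ultimately show ?thesis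
    by (simp add: h_def[abs_def])
qed

lemma le_sinh: "x \<le> sinh x" if "x \<ge> 0" for x :: real
proof -
  have "sinh 0 - 0 \<le> sinh x - x"
  proof (rule DERIV_nonneg_imp_nondecreasing[OF that])
    fix t :: real
    have "((\<lambda>t. sinh t - t) has_real_derivative cosh t - 1) (at t)"
      by (auto intro!: derivative_eq_intros)
    then show "\<exists>y. ((\<lambda>t. sinh t - t) has_real_derivative y) (at t) \<and> 0 \<le> y"
      using cosh_real_ge_1[of t] by force
  qed
  then show ?thesis by simp
qed

lemma h_ge: "h x \<ge> x" if "x \<ge> 0"
  using that by (simp add: h_def)

lemma h_le: "h x \<le> x" if "x \<le> 0"
  using le_sinh[of "-x"] that by (simp add: h_def)

lemma h_sum_ex1: "\<exists>!x. h (x + w) + h x = d"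
proof -
  let ?f = "\<lambda>x. h (x + w) + h x"
  define M where "M = \<bar>w\<bar> + \<bar>d\<bar>"
  have cont: "continuous_on A ?f" for A
    by (intro continuous_intros continuous_on_compose2[OF continuous_on_h]) auto
  have "?f (-M) \<le> d" "d \<le> ?f M"
    using h_le[of "-M + w"] h_le[of "-M"] h_ge[of "M + w"] h_ge[of M]
    unfolding M_def by linarith+
  then have "\<exists>x\<ge>-M. x \<le> M \<and> ?f x = d"
    by (intro IVT' cont) (auto simp: M_def)
  moreover have "x = y" if "?f x = ?f y" for x y
    using that h_less[of x y] h_less[of y x] h_less[of "x + w" "y + w"]
      h_less[of "y + w" "x + w"]
    by (cases x y rule: linorder_cases) auto
  ultimately show ?thesis
    by metis
qed

lemma connects_ex1:
  assumes "0 < a l" "(vl, ul, l) \<in> states" "(vr, ur, l) \<in> states"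
  shows "\<exists>!e. connects a (vl, ul, l) (vr, ur, l) e"
proof -
  define w where "w = ln (vr / vl) / 2"
  define d where "d = (ur - ul) / (2 * a l)"
  have pos: "0 < vl" "0 < vr" "l \<in> {0..1}"
    using assms by (auto simp: states_def)
  have vr: "vr = vl * exp (2 * w)"
    using pos by (simp add: w_def)
  have ur: "ur = ul + 2 * a l * d"
    using assms by (simp add: d_def)
  have iff: "connects a (vl, ul, l) (vr, ur, l) e \<longleftrightarrow>
      e Fam1 = e Fam3 + w \<and> h (e Fam3 + w) + h (e Fam3) = d" for e
  proof -
    have "connects a (vl, ul, l) (vr, ur, l) e \<longleftrightarrow>
       vl * exp (2 * w) = vl * exp (2 * e Fam1) * exp (- (2 * e Fam3)) \<and>
       ul + 2 * a l * d = ul + 2 * a l * h (e Fam1) + 2 * a l * h (e Fam3)"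
      using pos unfolding vr ur by (auto simp: connects_def wave_def states_def)
    also have "vl * exp (2 * w) = vl * exp (2 * e Fam1) * exp (- (2 * e Fam3)) \<longleftrightarrow>
        exp (2 * w) = exp (2 * e Fam1 - 2 * e Fam3)"
      using pos by (simp add: exp_diff exp_minus field_simps)
    also have "\<dots> \<longleftrightarrow> e Fam1 = e Fam3 + w"
      by auto
    also have "ul + 2 * a l * d = ul + 2 * a l * h (e Fam1) + 2 * a l * h (e Fam3) \<longleftrightarrow>
        2 * a l * d = 2 * a l * (h (e Fam1) + h (e Fam3))"
      by (simp add: algebra_simps)
    also have "\<dots> \<longleftrightarrow> h (e Fam1) + h (e Fam3) = d"
      using assms by auto
    finally show ?thesis
      by auto
  qed
  obtain x where x: "h (x + w) + h x = d" and uniq: "\<And>y. h (y + w) + h y = d \<Longrightarrow> y = x"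
    using h_sum_ex1[of w d] by auto
  show ?thesis
  proof (rule ex1I)
    show "connects a (vl, ul, l) (vr, ur, l) (case_family (x + w) x)"
      by (simp add: iff x)
  next
    fix e
    assume "connects a (vl, ul, l) (vr, ur, l) e"
    then have "e Fam3 = x" "e Fam1 = x + w"
      using uniq by (auto simp: iff)
    then show "e = case_family (x + w) x"
      by (intro ext) (auto split: family.split)
  qed
qed

end

theory Submission
  imports Defs
begin

text \<open>
  Let \<open>x\<close> and \<open>y\<close> be the transmitted and the reflected strength in an interaction of two waves
  \<open>\<alpha>\<close>, \<open>\<beta>\<close> of the same family. Eliminating the states leaves the two equations
  \<open>x - y = \<alpha> + \<beta>\<close> and \<open>h x + h y = h \<alpha> + h \<beta>\<close>, which are the same for both families. So \<open>y\<close> is the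
  root of an equation \<open>h (y + \<alpha> + \<beta>) + h y = h \<alpha> + h \<beta>\<close> with increasing left-hand side, and it is
  located by comparing the two sides at suitable points. For the quantitative bound the test point is
  \<open>- c \<alpha> * min \<bar>\<alpha>\<bar> \<bar>\<beta>\<bar>\<close>; the comparison there follows from the tangent-line inequality for \<open>sinh\<close>
  at \<open>\<bar>\<alpha>\<bar>\<close>, because \<open>c\<close> solves \<open>(1 - c z) * cosh z = 1 + c z\<close>.
\<close>

section \<open>Inequalities for \<open>sinh\<close>, \<open>h\<close> and \<open>c\<close>\<close>

lemma sinh_add_greater:
  fixes x y :: real
  assumes "0 < x" "0 < y"
  shows "sinh x + sinh y < sinh (x + y)"
proof -
  have "1 < cosh x" "1 < cosh y"
    using assms cosh_real_strict_mono[of 0] by auto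
  moreover have "0 < sinh x" "0 < sinh y"
    using assms by auto
  ultimately have "sinh x * 1 < sinh x * cosh y" "1 * sinh y < cosh x * sinh y"
    by (intro mult_strict_left_mono mult_strict_right_mono; simp)+
  then show ?thesis
    by (simp add: sinh_add)
qed

text \<open>Strictness comes from halving: superadditivity of \<open>sinh\<close> at
  \<open>x/2\<close> is strict, and the weak bound suffices for each half.\<close>

lemma less_sinh: "x < sinh x" if "0 < x" for x :: real
  using sinh_add_greater[of "x/2" "x/2"] le_sinh[of "x/2"] that by simp

text \<open>Convexity of \<open>sinh\<close> on the nonnegative axis:
  \<open>t * cosh x - sinh t\<close> has derivative \<open>cosh x - cosh t\<close>, nonnegative for
  t between y and x.\<close>

lemma sinh_diff_le_tangent:
  fixes x y :: real
  assumes "0 \<le> y" "y \<le> x"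
  shows "sinh x - sinh y \<le> (x - y) * cosh x"
proof -
  have "\<exists>d. ((\<lambda>t. t * cosh x - sinh t) has_real_derivative d) (at t) \<and> 0 \<le> d"
    if "y \<le> t" "t \<le> x" for t
  proof (intro exI conjI)
    show "((\<lambda>t. t * cosh x - sinh t) has_real_derivative cosh x - cosh t) (at t)"
      by (auto intro!: derivative_eq_intros)
    show "0 \<le> cosh x - cosh t"
      using that assms cosh_real_nonneg_le_iff[of t x] by simp
  qed
  from DERIV_nonneg_imp_nondecreasing[OF assms(2) this]
  show ?thesis
    by (simp add: algebra_simps)
qed

text \<open>Turns a comparison of values at a test point into a bound on the root; used below with
  \<open>w = \<alpha> + \<beta>\<close>.\<close>

lemma h_add_le_iff: "h (x + w) + h x \<le> h (y + w) + h y \<longleftrightarrow> x \<le> y"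
  using h_less[of x y] h_less[of y x] h_less[of "x + w" "y + w"] h_less[of "y + w" "x + w"]
  by (cases x y rule: linorder_cases) auto

lemma h_le_self: "h x \<le> x"
  using h_le[of x] by (cases "0 \<le> x") (simp add: h_def, simp)

lemma c_nonneg: "0 \<le> c z"
  using cosh_real_ge_1[of z] by (simp add: c_def)

lemma c_less_1: "c z < 1"
  using cosh_real_ge_1[of z] by (simp add: c_def divide_simps)

lemma c_cosh: "(1 - c z) * cosh z = 1 + c z"
  using cosh_real_ge_1[of z] by (simp add: c_def field_simps)

lemma c_minus [simp]: "c (- z) = c z"
  by (simp add: c_def)

section \<open>Reduction of interactions to equations between strengths\<close>

lemma connects_outgoing_eq:
  assumes "0 < a l" "connects a (v, u, l) Sr e"
  shows "outgoing a (v, u, l) Sr = e"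
proof -
  obtain v' u' where "Sr = (v', u', l)" "(v, u, l) \<in> states" "Sr \<in> states"
    using assms(2) by (auto simp: connects_def wave_def states_def)
  then show ?thesis
    using connects_ex1[of a l v u v' u'] assms unfolding outgoing_def
    by (blast intro: the1_equality)
qed

lemma connects_outgoing:
  assumes "0 < a l" "(v, u, l) \<in> states" "(v', u', l) \<in> states"
  shows "connects a (v, u, l) (v', u', l) (outgoing a (v, u, l) (v', u', l))"
  unfolding outgoing_def by (rule theI'[OF connects_ex1[of a l, OF assms]])

text \<open>A wave multiplies v by a factor and adds a term to u, both depending only on its
  strength, its family and \<lambda>. So the two waves commute, and uniqueness of the outgoing pair
  applies.\<close>

lemma outgoing_different_families:
  assumes "0 < a l" "wave a Fam3 \<delta>\<^sub>3 (v, u, l) Sm" "wave a Fam1 \<delta>\<^sub>1 Sm Sr"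
  shows "outgoing a (v, u, l) Sr Fam1 = \<delta>\<^sub>1" "outgoing a (v, u, l) Sr Fam3 = \<delta>\<^sub>3"
proof -
  have "connects a (v, u, l) Sr (case_family \<delta>\<^sub>1 \<delta>\<^sub>3)"
    using assms by (auto simp: connects_def wave_def states_def)
  from connects_outgoing_eq[OF assms(1) this]
  show "outgoing a (v, u, l) Sr Fam1 = \<delta>\<^sub>1" "outgoing a (v, u, l) Sr Fam3 = \<delta>\<^sub>3"
    by simp_all
qed

lemma outgoing_same_family:
  assumes "0 < a l" "wave a i \<alpha> (v, u, l) Sm" "wave a i \<beta> Sm Sr" "j \<noteq> i"
  shows "outgoing a (v, u, l) Sr i = outgoing a (v, u, l) Sr j + (\<alpha> + \<beta>)"
    and "h (outgoing a (v, u, l) Sr i) + h (outgoing a (v, u, l) Sr j) = h \<alpha> + h \<beta>"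
proof -
  define e where "e = outgoing a (v, u, l) Sr"
  have v: "0 < v" "l \<in> {0..1}"
    using assms by (auto simp: wave_def states_def)
  have Sr: "Sr = (v * exp (v_sign i * 2 * \<alpha>) * exp (v_sign i * 2 * \<beta>),
      u + 2 * a l * h \<alpha> + 2 * a l * h \<beta>, l)"
    using assms by (auto simp: wave_def)
  have "connects a (v, u, l) Sr e"
    unfolding e_def Sr using assms(1) v by (intro connects_outgoing) (auto simp: states_def)
  then have eqs: "v * exp (2 * e Fam1) * exp (- (2 * e Fam3)) =
      v * exp (v_sign i * 2 * \<alpha>) * exp (v_sign i * 2 * \<beta>)"
      "u + 2 * a l * h (e Fam1) + 2 * a l * h (e Fam3) = u + 2 * a l * h \<alpha> + 2 * a l * h \<beta>"
    by (auto simp: connects_def wave_def Sr)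
  \<comment> \<open>Cancel v, merge the exponentials and use injectivity of
    \<open>exp\<close>.\<close>
  have "2 * e Fam1 + - (2 * e Fam3) = v_sign i * 2 * \<alpha> + v_sign i * 2 * \<beta>"
    using eqs(1) v unfolding mult.assoc exp_add[symmetric] by simp
  then have "e Fam1 - e Fam3 = v_sign i * (\<alpha> + \<beta>)"
    by (simp add: algebra_simps)
  moreover have "2 * a l * (h (e Fam1) + h (e Fam3)) = 2 * a l * (h \<alpha> + h \<beta>)"
    using eqs(2) by (simp add: algebra_simps)
  then have "h (e Fam1) + h (e Fam3) = h \<alpha> + h \<beta>"
    using assms(1) by simp
  ultimately show "e i = e j + (\<alpha> + \<beta>)" "h (e i) + h (e j) = h \<alpha> + h \<beta>"
    using assms(4) by (cases i; cases j; simp)+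
qed

section \<open>Location of the reflected strength\<close>

lemma two_shocks:
  assumes "h (y + (\<alpha> + \<beta>)) + h y = h \<alpha> + h \<beta>" "\<alpha> < 0" "\<beta> < 0"
  shows "0 < y" "y + (\<alpha> + \<beta>) < \<alpha>" "y + (\<alpha> + \<beta>) < \<beta>"
proof -
  have "h (0 + (\<alpha> + \<beta>)) + h 0 < h \<alpha> + h \<beta>"
    using sinh_add_greater[of "- \<alpha>" "- \<beta>"] assms(2,3) sinh_minus[of "\<alpha> + \<beta>"]
    by (simp add: h_def)
  then show "0 < y"
    unfolding assms(1)[symmetric] not_le[symmetric] h_add_le_iff .
  \<comment> \<open>At the test point \<open>- \<beta>\<close> the first summand is
    \<open>h \<alpha>\<close>, so only \<open>h (- \<beta>)\<close> and \<open>h \<beta>\<close>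
    need comparing; likewise at \<open>- \<alpha>\<close>.\<close>
  have "h \<alpha> < h (- \<alpha>)" "h \<beta> < h (- \<beta>)"
    using assms(2,3) by (auto intro: h_less)
  then have "h (y + (\<alpha> + \<beta>)) + h y < h (- \<beta> + (\<alpha> + \<beta>)) + h (- \<beta>)"
      "h (y + (\<alpha> + \<beta>)) + h y < h (- \<alpha> + (\<alpha> + \<beta>)) + h (- \<alpha>)"
    unfolding assms(1) by simp_all
  then have "y < - \<beta>" "y < - \<alpha>"
    unfolding not_le[symmetric] h_add_le_iff .
  then show "y + (\<alpha> + \<beta>) < \<alpha>" "y + (\<alpha> + \<beta>) < \<beta>"
    by simp_all
qed

lemma shock_rarefaction:
  assumes "h (y + (\<alpha> + \<beta>)) + h y = h \<alpha> + h \<beta>" "\<alpha> < 0" "0 < \<beta>"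
  shows "y < 0" "\<alpha> < y + (\<alpha> + \<beta>)" "y + (\<alpha> + \<beta>) < \<beta>"
proof -
  have "h (0 + (\<alpha> + \<beta>)) + h 0 > h \<alpha> + h \<beta>"
  \<comment> \<open>The sign of \<open>\<alpha> + \<beta>\<close> selects the branch of
    \<open>h\<close>. When it is negative, \<bar>\<alpha>\<bar> is split into \<beta> and the
    positive remainder \<open>- \<alpha> - \<beta>\<close>.\<close>
  proof (cases "0 \<le> \<alpha> + \<beta>")
    case True
    then show ?thesis
      using less_sinh[of "- \<alpha>"] assms(2,3) by (simp add: h_def)
  next
    case False
    then show ?thesis
      using sinh_add_greater[of \<beta> "- \<alpha> - \<beta>"] le_sinh[of \<beta>] assms(2,3) sinh_minus[of "\<alpha> + \<beta>"]
      by (simp add: h_def)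
  qed
  then show "y < 0"
    unfolding assms(1)[symmetric] not_le[symmetric] h_add_le_iff .
  then show "y + (\<alpha> + \<beta>) < \<beta>"
    using assms(2) by simp
  have "h (- \<beta>) < h \<beta>"
    using assms(3) by (auto intro: h_less)
  then have "h (- \<beta> + (\<alpha> + \<beta>)) + h (- \<beta>) < h (y + (\<alpha> + \<beta>)) + h y"
    unfolding assms(1) by simp
  then have "- \<beta> < y"
    unfolding not_le[symmetric] h_add_le_iff .
  then show "\<alpha> < y + (\<alpha> + \<beta>)"
    by simp
qed

lemma shock_rarefaction_reflected_bound:
  assumes "h (y + (\<alpha> + \<beta>)) + h y = h \<alpha> + h \<beta>" "\<alpha> < 0" "0 < \<beta>"
  shows "\<bar>y\<bar> \<le> c \<alpha> * min \<bar>\<alpha>\<bar> \<bar>\<beta>\<bar>"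
proof -
  define A where "A = - \<alpha>"
  define M where "M = min A \<beta>"
  define m where "m = c \<alpha> * M"
  have A: "\<alpha> = - A" "0 < A" and M: "0 < M" "M \<le> A" "M \<le> \<beta>"
    using assms by (auto simp: A_def M_def)
  have m: "0 \<le> m" "m \<le> M"
    using M c_nonneg[of \<alpha>] c_less_1[of \<alpha>] by (auto simp: m_def intro: mult_left_le_one_le)
  \<comment> \<open>The interval ending at A has length \<open>M - m = (1 - c A) * M\<close>, so
    \<open>c_cosh\<close> turns the tangent increment \<open>(M - m) * cosh A\<close> into
    \<open>M + m\<close>.\<close>
  have key: "sinh A \<le> sinh (A - (M - m)) + M + m"
  proof -
    have "sinh A - sinh (A - (M - m)) \<le> (A - (A - (M - m))) * cosh A"
      using M m by (intro sinh_diff_le_tangent) auto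
    also have "\<dots> = M * ((1 - c A) * cosh A)"
      by (simp add: m_def A algebra_simps)
    also have "\<dots> = M + m"
      unfolding c_cosh by (simp add: m_def A algebra_simps)
    finally show ?thesis
      by simp
  qed
  have "h (- m + (\<alpha> + \<beta>)) + h (- m) \<le> h \<alpha> + h \<beta>"
  proof -
    have h: "h \<alpha> = - sinh A" "h \<beta> = \<beta>" "h (- m) = - sinh m"
      using A m assms(3) by (auto simp: h_def)
    have "h (- m + (\<alpha> + \<beta>)) \<le> \<beta> - sinh A + sinh m"
    proof (cases "A \<le> \<beta>")
      case True
      then have "M = A"
        by (simp add: M_def)
      then have *: "sinh A \<le> sinh m + A + m"
        using key by simp
      \<comment> \<open>The sign of this argument is undetermined, so \<open>h\<close> is bounded by
        the identity, which holds on both branches.\<close>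
      have "h (\<beta> - A - m) \<le> \<beta> - A - m"
        by (rule h_le_self)
      then show ?thesis
        using * by (simp add: A algebra_simps)
    next
      case False
      then have "M = \<beta>"
        by (simp add: M_def)
      then have *: "sinh A \<le> sinh (A - \<beta> + m) + \<beta> + m"
        using key by (simp add: algebra_simps)
      \<comment> \<open>Here the argument is negative, so \<open>h\<close> is exactly the
        \<open>sinh\<close> term of \<open>key\<close>; the leftover m is absorbed by
        \<open>sinh m\<close>.\<close>
      have "h (- (A - \<beta> + m)) = - sinh (A - \<beta> + m)"
        using False m by (simp add: h_def sinh_minus[symmetric] del: sinh_minus)
      then show ?thesis
        using * le_sinh[OF m(1)] by (simp add: A algebra_simps)
    qed
    then show ?thesis
      using h by simp
  qed
  then have "- m \<le> y"
    unfolding assms(1)[symmetric] h_add_le_iff .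
  then show ?thesis
    using shock_rarefaction(1)[OF assms] assms(3) A by (simp add: m_def M_def)
qed

theorem lemma5p4:
  fixes a :: "real \<Rightarrow> real" and l :: real
  assumes "admissible_pressure_coeff a"
    and "l \<in> {0..1}"
  shows
    "(\<forall>v u Sm Sr \<delta>\<^sub>1 \<delta>\<^sub>3.
        wave a Fam3 \<delta>\<^sub>3 (v, u, l) Sm \<and> wave a Fam1 \<delta>\<^sub>1 Sm Sr \<longrightarrow>
        outgoing a (v, u, l) Sr Fam1 = \<delta>\<^sub>1 \<and> outgoing a (v, u, l) Sr Fam3 = \<delta>\<^sub>3)
     \<and>
     (\<forall>i j v u Sm Sr \<alpha> \<beta>.
        j \<noteq> i \<and> wave a i \<alpha> (v, u, l) Sm \<and> wave a i \<beta> Sm Sr \<and> is_shock \<alpha> \<and> is_shock \<beta> \<longrightarrow>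
        is_shock (outgoing a (v, u, l) Sr i) \<and>
        \<bar>outgoing a (v, u, l) Sr i\<bar> > max \<bar>\<alpha>\<bar> \<bar>\<beta>\<bar> \<and>
        is_rarefaction (outgoing a (v, u, l) Sr j))
     \<and>
     (\<forall>i j v u Sm Sr \<alpha> \<beta>.
        j \<noteq> i \<and> wave a i \<alpha> (v, u, l) Sm \<and> wave a i \<beta> Sm Sr \<and>
        (is_shock \<alpha> \<and> is_rarefaction \<beta> \<or> is_rarefaction \<alpha> \<and> is_shock \<beta>) \<longrightarrow>
        is_shock (outgoing a (v, u, l) Sr j) \<and>
        shock_amount [outgoing a (v, u, l) Sr i] < shock_amount [\<alpha>, \<beta>] \<and>
        rarefaction_amount [outgoing a (v, u, l) Sr i] < rarefaction_amount [\<alpha>, \<beta>])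
     \<and>
     (\<forall>i j v u Sm Sr \<alpha> \<beta>.
        j \<noteq> i \<and> \<alpha> < 0 \<and> 0 < \<beta> \<and>
        (wave a i \<alpha> (v, u, l) Sm \<and> wave a i \<beta> Sm Sr \<or>
         wave a i \<beta> (v, u, l) Sm \<and> wave a i \<alpha> Sm Sr) \<longrightarrow>
        \<bar>outgoing a (v, u, l) Sr j\<bar> \<le> c \<alpha> * min \<bar>\<alpha>\<bar> \<bar>\<beta>\<bar>)"
proof (intro conjI allI impI; (elim conjE)?)
  have al: "0 < a l"
    using assms by (auto simp: admissible_pressure_coeff_def)
  {
    fix v u Sm Sr \<delta>\<^sub>1 \<delta>\<^sub>3
    assume "wave a Fam3 \<delta>\<^sub>3 (v, u, l) Sm" "wave a Fam1 \<delta>\<^sub>1 Sm Sr"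
    from outgoing_different_families[OF al this]
    show "outgoing a (v, u, l) Sr Fam1 = \<delta>\<^sub>1" "outgoing a (v, u, l) Sr Fam3 = \<delta>\<^sub>3" .
  next
    fix i j :: family and v u Sm Sr \<alpha> \<beta>
    assume ij: "j \<noteq> i" and w: "wave a i \<alpha> (v, u, l) Sm" "wave a i \<beta> Sm Sr"
      and s: "is_shock \<alpha>" "is_shock \<beta>"
    note eqs = outgoing_same_family[OF al w ij]
    note * = two_shocks[OF eqs(2)[unfolded eqs(1)] s[unfolded is_shock_def], folded eqs(1)]
    show "is_shock (outgoing a (v, u, l) Sr i)"
        "\<bar>outgoing a (v, u, l) Sr i\<bar> > max \<bar>\<alpha>\<bar> \<bar>\<beta>\<bar>"
        "is_rarefaction (outgoing a (v, u, l) Sr j)"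
      using * s by (auto simp: is_shock_def is_rarefaction_def)
  next
    fix i j :: family and v u Sm Sr \<alpha> \<beta>
    assume ij: "j \<noteq> i" and w: "wave a i \<alpha> (v, u, l) Sm" "wave a i \<beta> Sm Sr"
      and s: "is_shock \<alpha> \<and> is_rarefaction \<beta> \<or> is_rarefaction \<alpha> \<and> is_shock \<beta>"
    note eqs = outgoing_same_family[OF al w ij]
    note eq = eqs(2)[unfolded eqs(1)]
    \<comment> \<open>The equation is symmetric in the incoming strengths, so a rarefaction on the
      left is covered by exchanging them.\<close>
    have eq': "h (outgoing a (v, u, l) Sr j + (\<beta> + \<alpha>)) + h (outgoing a (v, u, l) Sr j) =
        h \<beta> + h \<alpha>"
      using eq by (simp add: add.commute)
    \<comment> \<open>Since \<open>min \<alpha> \<beta> < 0 < max \<alpha> \<beta>\<close>, a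
      transmitted strength strictly between them lowers both amounts, whatever its sign.\<close>
    from s have *: "outgoing a (v, u, l) Sr j < 0 \<and>
        min \<alpha> \<beta> < outgoing a (v, u, l) Sr i \<and> outgoing a (v, u, l) Sr i < max \<alpha> \<beta>"
      using shock_rarefaction[OF eq] shock_rarefaction[OF eq'] eqs(1)
      by (auto simp: is_shock_def is_rarefaction_def)
    then show "is_shock (outgoing a (v, u, l) Sr j)"
        "shock_amount [outgoing a (v, u, l) Sr i] < shock_amount [\<alpha>, \<beta>]"
        "rarefaction_amount [outgoing a (v, u, l) Sr i] < rarefaction_amount [\<alpha>, \<beta>]"
      using s by (auto simp: is_shock_def is_rarefaction_def shock_amount_def
          rarefaction_amount_def split: if_splits)
  next
    fix i j :: family and v u Sm Sr \<alpha> \<beta>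
    assume ij: "j \<noteq> i" and s: "\<alpha> < 0" "0 < \<beta>"
      and "wave a i \<alpha> (v, u, l) Sm \<and> wave a i \<beta> Sm Sr \<or>
           wave a i \<beta> (v, u, l) Sm \<and> wave a i \<alpha> Sm Sr"
    then have "h (outgoing a (v, u, l) Sr j + (\<alpha> + \<beta>)) + h (outgoing a (v, u, l) Sr j) = h \<alpha> + h \<beta>"
      using outgoing_same_family[of a l i \<alpha> v u Sm \<beta> Sr j, OF al]
        outgoing_same_family[of a l i \<beta> v u Sm \<alpha> Sr j, OF al]
      by (auto simp: add.commute)
    then show "\<bar>outgoing a (v, u, l) Sr j\<bar> \<le> c \<alpha> * min \<bar>\<alpha>\<bar> \<bar>\<beta>\<bar>"
      using s by (rule shock_rarefaction_reflected_bound)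
  }
qed

end
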